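(* Let $(K,\rho)$ be a compact metric space that is not a singleton. Then the Banach space $\mathrm{Lip}(K)$ has the Daugavet property if and only if $K$ is local.
   Context: For a metric space $(K,\rho)$, the space of all Lipschitz functions $f\colon K\to\mathbb{R}$ carries the seminorm $$\|f\|=\sup\Bigl\{\frac{|f(t_1)-f(t_2)|}{\rho(t_1,t_2)} : t_1\neq t_2\in K\Bigr\}.$$ $\mathrm{Lip}(K)$ denotes the Banach space obtained by quotienting out the constant functions (the kernel of the seminorm), with the induced norm, also denoted $\|\cdot\|$. Elements of $\mathrm{Lip}(K)$ are referred to as functions. A Banach space $X$ has the Daugavet property if $\|\mathrm{Id}+T\|=1+\|T\|$ for every bounded rank-1 operator $T\colon X\to X$. A metric space $K$ is called local if for every $\varepsilon>0$ and every $f\in\mathrm{Lip}(K)$ there are two distinct points $\tau_1,\tau_2\in K$ such that $\rho(\tau_1,\tau_2)<\varepsilon$ and $$\frac{f(\tau_2)-f(\tau_1)}{\rho(\tau_1,\tau_2)}>\|f\|-\varepsilon.$$ *)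

theory Defs
  imports "HOL-Analysis.Analysis"
begin

definition is_lipschitz :: "('a::metric_space \<Rightarrow> real) \<Rightarrow> bool"
  where "is_lipschitz f \<longleftrightarrow> (\<exists>C. C-lipschitz_on UNIV f)"

text \<open>The inserted \<open>0\<close> only matters on a one-point space, where the set of difference
  quotients is empty and its real supremum would be unspecified.\<close>

definition lip_seminorm :: "('a::metric_space \<Rightarrow> real) \<Rightarrow> real"
  where "lip_seminorm f = Sup (insert 0 {\<bar>f s - f t\<bar> / dist s t | s t. s \<noteq> t})"

lemma is_lipschitzI:
  assumes "\<And>s t. \<bar>f s - f t\<bar> \<le> C * dist s t"
  shows "is_lipschitz f"
proof -
  have "\<bar>f s - f t\<bar> \<le> \<bar>C\<bar> * dist s t" for s t
    by (rule order_trans[OF assms]) (simp add: mult_right_mono)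
  then have "\<bar>C\<bar>-lipschitz_on UNIV f"
    by (auto simp: lipschitz_on_def dist_real_def)
  then show ?thesis unfolding is_lipschitz_def by blast
qed

lemma lip_seminorm_bound:
  assumes "is_lipschitz f"
  shows "\<bar>f s - f t\<bar> \<le> lip_seminorm f * dist s t"
proof (cases "s = t")
  case False
  obtain C where C: "C-lipschitz_on UNIV f" using assms is_lipschitz_def by blast
  have "bdd_above (insert 0 {\<bar>f s - f t\<bar> / dist s t | s t. s \<noteq> t})"
  proof (rule bdd_aboveI[of _ C])
    fix x assume "x \<in> insert 0 {\<bar>f s - f t\<bar> / dist s t | s t. s \<noteq> t}"
    then show "x \<le> C"
      using C by (auto simp: lipschitz_on_def dist_real_def divide_le_eq)
  qed
  then have "\<bar>f s - f t\<bar> / dist s t \<le> lip_seminorm f"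
    unfolding lip_seminorm_def using False by (intro cSup_upper) auto
  then show ?thesis using False by (simp add: divide_le_eq)
qed simp

lemma lip_seminorm_least:
  assumes "0 \<le> C" "\<And>s t. \<bar>f s - f t\<bar> \<le> C * dist s t"
  shows "lip_seminorm f \<le> C"
  unfolding lip_seminorm_def
  using assms by (intro cSup_least) (auto simp: divide_le_eq)

lemma lip_seminorm_nonneg:
  assumes "is_lipschitz f"
  shows "0 \<le> lip_seminorm f"
proof (cases "\<exists>s t::'a. s \<noteq> t")
  case True
  then obtain s t :: 'a where "s \<noteq> t" by blast
  moreover have "0 \<le> lip_seminorm f * dist s t"
    using lip_seminorm_bound[OF assms, of s t] by linarith
  ultimately show ?thesis by (simp add: zero_le_mult_iff)
next
  case False
  then have "{\<bar>f s - f t\<bar> / dist s t | s t. s \<noteq> t} = {}" by blast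
  then show ?thesis by (simp add: lip_seminorm_def)
qed

lemma is_lipschitz_const: "is_lipschitz (\<lambda>_. c)"
  by (rule is_lipschitzI[of _ 0]) simp

lemma add_bound:
  assumes "is_lipschitz f" "is_lipschitz g"
  shows "\<bar>(f s + g s) - (f t + g t)\<bar> \<le> (lip_seminorm f + lip_seminorm g) * dist s t"
  using lip_seminorm_bound[OF assms(1), of s t] lip_seminorm_bound[OF assms(2), of s t]
  by (simp add: distrib_right)

lemma scale_bound:
  assumes "is_lipschitz f"
  shows "\<bar>a * f s - a * f t\<bar> \<le> (\<bar>a\<bar> * lip_seminorm f) * dist s t"
proof -
  have "\<bar>a * f s - a * f t\<bar> = \<bar>a\<bar> * \<bar>f s - f t\<bar>"
    by (simp add: abs_mult[symmetric] right_diff_distrib)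
  also have "\<dots> \<le> \<bar>a\<bar> * (lip_seminorm f * dist s t)"
    by (rule mult_left_mono[OF lip_seminorm_bound[OF assms]]) simp
  finally show ?thesis by (simp add: mult.assoc)
qed

lemma is_lipschitz_add:
  "is_lipschitz f \<Longrightarrow> is_lipschitz g \<Longrightarrow> is_lipschitz (\<lambda>x. f x + g x)"
  by (rule is_lipschitzI[OF add_bound])

lemma is_lipschitz_scale:
  "is_lipschitz f \<Longrightarrow> is_lipschitz (\<lambda>x. a * f x)"
  by (rule is_lipschitzI[OF scale_bound])

lemma is_lipschitz_uminus:
  "is_lipschitz f \<Longrightarrow> is_lipschitz (\<lambda>x. - f x)"
  using is_lipschitz_scale[of f "-1"] by simp

lemma is_lipschitz_diff:
  "is_lipschitz f \<Longrightarrow> is_lipschitz g \<Longrightarrow> is_lipschitz (\<lambda>x. f x - g x)"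
  using is_lipschitz_add[OF _ is_lipschitz_uminus, of f g] by simp

lemma lip_seminorm_add:
  assumes "is_lipschitz f" "is_lipschitz g"
  shows "lip_seminorm (\<lambda>x. f x + g x) \<le> lip_seminorm f + lip_seminorm g"
  by (rule lip_seminorm_least)
    (simp_all only: add_bound[OF assms] add_nonneg_nonneg lip_seminorm_nonneg assms)

lemma lip_seminorm_scale:
  assumes "is_lipschitz f"
  shows "lip_seminorm (\<lambda>x. a * f x) = \<bar>a\<bar> * lip_seminorm f"
proof (rule antisym)
  have le: "lip_seminorm (\<lambda>x. b * g x) \<le> \<bar>b\<bar> * lip_seminorm g"
    if "is_lipschitz g" for b and g :: "'a \<Rightarrow> real"
    by (rule lip_seminorm_least)
      (simp_all only: scale_bound[OF that] mult_nonneg_nonneg abs_ge_zero lip_seminorm_nonneg that)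
  show "lip_seminorm (\<lambda>x. a * f x) \<le> \<bar>a\<bar> * lip_seminorm f"
    by (rule le[OF assms])
  show "\<bar>a\<bar> * lip_seminorm f \<le> lip_seminorm (\<lambda>x. a * f x)"
  proof (cases "a = 0")
    case True
    then show ?thesis using lip_seminorm_nonneg[OF is_lipschitz_const[of 0]] by simp
  next
    case False
    then have "lip_seminorm f \<le> \<bar>inverse a\<bar> * lip_seminorm (\<lambda>x. a * f x)"
      using le[OF is_lipschitz_scale[OF assms, of a], of "inverse a"]
      by (simp add: mult.assoc[symmetric])
    then show ?thesis using False by (simp add: field_simps)
  qed
qed

definition lip_rel :: "('a::metric_space \<Rightarrow> real) \<Rightarrow> ('a \<Rightarrow> real) \<Rightarrow> bool"
  where "lip_rel f g \<longleftrightarrow> is_lipschitz f \<and> is_lipschitz g \<and> (\<exists>c. \<forall>x. f x - g x = c)"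

lemma part_equivp_lip_rel: "part_equivp (lip_rel :: ('a::metric_space \<Rightarrow> real) \<Rightarrow> _)"
proof (rule part_equivpI)
  show "\<exists>f :: 'a \<Rightarrow> real. lip_rel f f"
    using is_lipschitz_const[of 0] by (auto simp: lip_rel_def)
  show "symp (lip_rel :: ('a \<Rightarrow> real) \<Rightarrow> _)"
  proof (rule sympI)
    fix f g :: "'a \<Rightarrow> real"
    assume "lip_rel f g"
    then obtain c where "is_lipschitz f" "is_lipschitz g" "\<And>x. f x - g x = c"
      by (auto simp: lip_rel_def)
    moreover from this(3) have "g x - f x = - c" for x by (metis minus_diff_eq)
    ultimately show "lip_rel g f" unfolding lip_rel_def by blast
  qed
  show "transp (lip_rel :: ('a \<Rightarrow> real) \<Rightarrow> _)"
  proof (rule transpI)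
    fix f g h :: "'a \<Rightarrow> real"
    assume "lip_rel f g" "lip_rel g h"
    then obtain c d where "is_lipschitz f" "is_lipschitz h"
      "\<And>x. f x - g x = c" "\<And>x. g x - h x = d"
      by (auto simp: lip_rel_def)
    moreover have "f x - h x = c + d" for x
      using calculation(3)[of x] calculation(4)[of x] by simp
    ultimately show "lip_rel f h" unfolding lip_rel_def by blast
  qed
qed

lemma lip_seminorm_cong:
  assumes "lip_rel f g"
  shows "lip_seminorm f = lip_seminorm g"
proof -
  obtain c where c: "\<And>x. f x - g x = c" using assms by (auto simp: lip_rel_def)
  have "f s - f t = g s - g t" for s t
    using c[of s] c[of t] by simp
  then show ?thesis by (simp add: lip_seminorm_def)
qed

quotient_type (overloaded) 'a Lip = "'a::metric_space \<Rightarrow> real" / partial: lip_rel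
  by (rule part_equivp_lip_rel)

instantiation Lip :: (metric_space) real_normed_vector
begin

lift_definition zero_Lip :: "'a Lip" is "\<lambda>_. 0"
  by (auto simp: lip_rel_def is_lipschitz_const)

lift_definition plus_Lip :: "'a Lip \<Rightarrow> 'a Lip \<Rightarrow> 'a Lip" is "\<lambda>f g x. f x + g x"
proof -
  fix f f' g g' :: "'a \<Rightarrow> real"
  assume "lip_rel f f'" "lip_rel g g'"
  then obtain c d where *: "is_lipschitz f" "is_lipschitz f'" "is_lipschitz g" "is_lipschitz g'"
    "\<And>x. f x - f' x = c" "\<And>x. g x - g' x = d"
    by (auto simp: lip_rel_def)
  have "f x + g x - (f' x + g' x) = c + d" for x
    using *(5)[of x] *(6)[of x] by simp
  with * show "lip_rel (\<lambda>x. f x + g x) (\<lambda>x. f' x + g' x)"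
    unfolding lip_rel_def by (blast intro: is_lipschitz_add)
qed

lift_definition scaleR_Lip :: "real \<Rightarrow> 'a Lip \<Rightarrow> 'a Lip" is "\<lambda>a f x. a * f x"
proof -
  fix a and f f' :: "'a \<Rightarrow> real"
  assume "lip_rel f f'"
  then obtain c where *: "is_lipschitz f" "is_lipschitz f'" "\<And>x. f x - f' x = c"
    by (auto simp: lip_rel_def)
  have "a * f x - a * f' x = a * c" for x
    by (simp add: right_diff_distrib[symmetric] *(3))
  with * show "lip_rel (\<lambda>x. a * f x) (\<lambda>x. a * f' x)"
    unfolding lip_rel_def by (blast intro: is_lipschitz_scale)
qed

lift_definition norm_Lip :: "'a Lip \<Rightarrow> real" is lip_seminorm
  by (rule lip_seminorm_cong)

definition uminus_Lip :: "'a Lip \<Rightarrow> 'a Lip"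
  where "uminus_Lip f = (-1) *\<^sub>R f"

definition minus_Lip :: "'a Lip \<Rightarrow> 'a Lip \<Rightarrow> 'a Lip"
  where "minus_Lip f g = f + - g"

definition sgn_Lip :: "'a Lip \<Rightarrow> 'a Lip"
  where "sgn_Lip f = inverse (norm f) *\<^sub>R f"

definition dist_Lip :: "'a Lip \<Rightarrow> 'a Lip \<Rightarrow> real"
  where "dist_Lip f g = norm (f - g)"

definition uniformity_Lip :: "('a Lip \<times> 'a Lip) filter"
  where "uniformity_Lip = (INF e\<in>{0<..}. principal {(x, y). dist x y < e})"

definition open_Lip :: "'a Lip set \<Rightarrow> bool"
  where "open_Lip U \<longleftrightarrow> (\<forall>x\<in>U. eventually (\<lambda>(x', y). x' = x \<longrightarrow> y \<in> U) uniformity)"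

instance
proof
  fix f g h :: "'a Lip" and a b :: real and U :: "'a Lip set"
  show "f + g + h = f + (g + h)"
    by transfer (auto simp: lip_rel_def algebra_simps intro!: is_lipschitz_add)
  show "f + g = g + f"
    by transfer (auto simp: lip_rel_def algebra_simps intro!: is_lipschitz_add)
  show "0 + f = f"
    by transfer (auto simp: lip_rel_def)
  show "- f + f = 0"
    unfolding uminus_Lip_def
    by transfer (auto simp: lip_rel_def is_lipschitz_const)
  show "f - g = f + - g" by (rule minus_Lip_def)
  show "a *\<^sub>R (f + g) = a *\<^sub>R f + a *\<^sub>R g"
    by transfer (auto simp: lip_rel_def distrib_left intro!: is_lipschitz_add is_lipschitz_scale)
  show "(a + b) *\<^sub>R f = a *\<^sub>R f + b *\<^sub>R f"
    by transfer (auto simp: lip_rel_def distrib_right intro!: is_lipschitz_add is_lipschitz_scale)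
  show "a *\<^sub>R b *\<^sub>R f = (a * b) *\<^sub>R f"
    by transfer (auto simp: lip_rel_def mult.assoc intro!: is_lipschitz_scale)
  show "1 *\<^sub>R f = f"
    by transfer (auto simp: lip_rel_def)
  show "dist f g = norm (f - g)" by (rule dist_Lip_def)
  show "sgn f = inverse (norm f) *\<^sub>R f" by (rule sgn_Lip_def)
  show "(uniformity :: ('a Lip \<times> 'a Lip) filter) =
      (INF e\<in>{0<..}. principal {(x, y). dist x y < e})"
    by (rule uniformity_Lip_def)
  show "open U \<longleftrightarrow> (\<forall>x\<in>U. \<forall>\<^sub>F (x', y) in uniformity. x' = x \<longrightarrow> y \<in> U)"
    by (rule open_Lip_def)
  show "norm (f + g) \<le> norm f + norm g"
    by transfer (auto simp: lip_rel_def intro!: lip_seminorm_add)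
  show "norm (a *\<^sub>R f) = \<bar>a\<bar> * norm f"
    by transfer (auto simp: lip_rel_def intro!: lip_seminorm_scale)
  show "norm f = 0 \<longleftrightarrow> f = 0"
  proof transfer
    fix f :: "'a \<Rightarrow> real"
    assume "lip_rel f f"
    then have f: "is_lipschitz f" by (simp add: lip_rel_def)
    show "lip_seminorm f = 0 \<longleftrightarrow> lip_rel f (\<lambda>_. 0)"
    proof
      assume "lip_seminorm f = 0"
      then have "f x = f undefined" for x
        using lip_seminorm_bound[OF f, of x undefined] by simp
      then show "lip_rel f (\<lambda>_. 0)"
        unfolding lip_rel_def using f is_lipschitz_const by (metis diff_zero)
    next
      assume "lip_rel f (\<lambda>_. 0)"
      then have "lip_seminorm f = lip_seminorm (\<lambda>_::'a. 0)" by (rule lip_seminorm_cong)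
      also have "\<dots> = 0"
        using lip_seminorm_scale[OF is_lipschitz_const[of 0], of 0] by simp
      finally show "lip_seminorm f = 0" .
    qed
  qed
qed

end

lemma abs_Lip_surj: "\<exists>g. is_lipschitz g \<and> F = abs_Lip g"
proof -
  have "lip_rel (rep_Lip F) (rep_Lip F)" by (rule Quotient3_rel_rep[OF Quotient3_Lip, THEN iffD2]) simp
  moreover have "F = abs_Lip (rep_Lip F)"
    by (simp add: Quotient3_abs_rep[OF Quotient3_Lip])
  ultimately show ?thesis unfolding lip_rel_def by blast
qed

lemma norm_abs_Lip:
  assumes "is_lipschitz g"
  shows "norm (abs_Lip g) = lip_seminorm g"
  by (rule norm_Lip.abs_eq) (simp add: lip_rel_def assms)

lemma abs_Lip_diff:
  assumes "is_lipschitz f" "is_lipschitz g"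
  shows "abs_Lip f - abs_Lip g = abs_Lip (\<lambda>x. f x - g x)"
proof -
  have 1: "- abs_Lip g = abs_Lip (\<lambda>x. -1 * g x)"
    unfolding uminus_Lip_def
    by (rule scaleR_Lip.abs_eq) (simp add: lip_rel_def assms)
  have "abs_Lip f + abs_Lip (\<lambda>x. -1 * g x) = abs_Lip (\<lambda>x. f x + -1 * g x)"
    by (rule plus_Lip.abs_eq) (use assms is_lipschitz_scale[of g "-1"] in \<open>auto simp: lip_rel_def\<close>)
  then show ?thesis by (simp only: minus_Lip_def 1) simp
qed

instance Lip :: (metric_space) banach
proof
  fix X :: "nat \<Rightarrow> 'a Lip"
  assume X: "Cauchy X"
  have "\<forall>n. \<exists>g. is_lipschitz g \<and> X n = abs_Lip g" using abs_Lip_surj by blast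
  then obtain r where r: "\<And>n. is_lipschitz (r n)" "\<And>n. X n = abs_Lip (r n)"
    using choice[of "\<lambda>n g. is_lipschitz g \<and> X n = abs_Lip g"] by blast
  define p :: 'a where "p = undefined"
  have bound: "\<bar>(r n s - r m s) - (r n t - r m t)\<bar> \<le> norm (X n - X m) * dist s t" for n m s t
    using lip_seminorm_bound[OF is_lipschitz_diff[OF r(1)[of n] r(1)[of m]], of s t]
    by (simp add: r abs_Lip_diff norm_abs_Lip is_lipschitz_diff)
  have "Cauchy (\<lambda>n. r n s - r n p)" for s
  proof (rule CauchyI)
    fix e :: real assume "0 < e"
    define d where "d = e / (dist s p + 1)"
    have "0 < d" using \<open>0 < e\<close> by (simp add: d_def add_nonneg_pos)
    then obtain N where N: "\<And>m n. m \<ge> N \<Longrightarrow> n \<ge> N \<Longrightarrow> norm (X m - X n) < d"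
      using CauchyD[OF X] by blast
    show "\<exists>M. \<forall>m\<ge>M. \<forall>n\<ge>M. norm ((r m s - r m p) - (r n s - r n p)) < e"
    proof (intro exI[of _ N] allI impI)
      fix m n assume "N \<le> m" "N \<le> n"
      have "norm ((r m s - r m p) - (r n s - r n p)) \<le> norm (X m - X n) * dist s p"
        using bound[of m s n p] by (simp add: algebra_simps)
      also have "\<dots> \<le> d * dist s p"
        using N[OF \<open>N \<le> m\<close> \<open>N \<le> n\<close>] by (intro mult_right_mono) auto
      also have "\<dots> < d * (dist s p + 1)" using \<open>0 < d\<close> by (simp add: distrib_left)
      also have "\<dots> = e" unfolding d_def using zero_le_dist[of s p] by (simp add: add_nonneg_eq_0_iff)
      finally show "norm ((r m s - r m p) - (r n s - r n p)) < e" .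
    qed
  qed
  then have "\<exists>l. (\<lambda>n. r n s - r n p) \<longlonglongrightarrow> l" for s
    using convergent_eq_Cauchy by blast
  then obtain g where g: "\<And>s. (\<lambda>n. r n s - r n p) \<longlonglongrightarrow> g s" by metis
  have close: "\<bar>(r n s - g s) - (r n t - g t)\<bar> \<le> e * dist s t"
    if N: "\<And>m. m \<ge> N \<Longrightarrow> norm (X n - X m) < e" for n N e s t
  proof -
    have lim: "(\<lambda>m. \<bar>(r n s - (r m s - r m p)) - (r n t - (r m t - r m p))\<bar>)
        \<longlonglongrightarrow> \<bar>(r n s - g s) - (r n t - g t)\<bar>"
      by (intro tendsto_intros g)
    have "\<bar>(r n s - (r m s - r m p)) - (r n t - (r m t - r m p))\<bar> \<le> e * dist s t"
      if "m \<ge> N" for m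
    proof -
      have "\<bar>(r n s - (r m s - r m p)) - (r n t - (r m t - r m p))\<bar> \<le> norm (X n - X m) * dist s t"
        using bound[of n s m t] by (simp add: algebra_simps)
      also have "\<dots> \<le> e * dist s t"
        using N[OF that] by (intro mult_right_mono) auto
      finally show ?thesis .
    qed
    then show ?thesis using LIMSEQ_le_const2[OF lim] by blast
  qed
  obtain N1 where N1: "\<And>m n. m \<ge> N1 \<Longrightarrow> n \<ge> N1 \<Longrightarrow> norm (X m - X n) < 1"
    using CauchyD[OF X, of 1] zero_less_one by blast
  have "is_lipschitz (\<lambda>x. r N1 x - g x)"
    by (rule is_lipschitzI[OF close[of N1 N1 1]]) (use N1 in auto)
  then have "is_lipschitz (\<lambda>x. r N1 x - (r N1 x - g x))"
    by (rule is_lipschitz_diff[OF r(1)])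
  then have lg: "is_lipschitz g" by simp
  have "X \<longlonglongrightarrow> abs_Lip g"
  proof (rule LIMSEQ_I)
    fix e :: real assume "0 < e"
    then obtain N where N: "\<And>m n. m \<ge> N \<Longrightarrow> n \<ge> N \<Longrightarrow> norm (X m - X n) < e / 2"
      using CauchyD[OF X, of "e / 2"] by (metis half_gt_zero)
    have "norm (X n - abs_Lip g) < e" if "n \<ge> N" for n
    proof -
      have "norm (X n - abs_Lip g) = lip_seminorm (\<lambda>x. r n x - g x)"
        by (simp add: r lg abs_Lip_diff norm_abs_Lip is_lipschitz_diff)
      also have "\<dots> \<le> e / 2"
        by (rule lip_seminorm_least) (use \<open>0 < e\<close> close[of N n "e / 2"] N that in auto)
      finally show ?thesis using \<open>0 < e\<close> by simp
    qed
    then show "\<exists>no. \<forall>n\<ge>no. norm (X n - abs_Lip g) < e" by blast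
  qed
  then show "convergent X" by (rule convergentI)
qed

text \<open>\<open>dim\<close> is \<open>0\<close> on infinite-dimensional subspaces, so the condition below says
  exactly that \<open>T\<close> has rank one.\<close>

definition daugavet_property :: "'b::banach itself \<Rightarrow> bool"
  where "daugavet_property _ \<longleftrightarrow>
    (\<forall>T :: 'b \<Rightarrow>\<^sub>L 'b. dim (range (blinfun_apply T)) = 1 \<longrightarrow>
      norm (id_blinfun + T) = 1 + norm T)"

text \<open>Locality is stated on representatives: neither the difference quotients nor the seminorm
  change when a constant is added to \<open>f\<close>.\<close>

definition local_metric_space :: "'a::metric_space itself \<Rightarrow> bool"
  where "local_metric_space _ \<longleftrightarrow>
    (\<forall>\<epsilon>>0. \<forall>f :: 'a \<Rightarrow> real. is_lipschitz f \<longrightarrow>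
      (\<exists>\<tau>\<^sub>1 \<tau>\<^sub>2. \<tau>\<^sub>1 \<noteq> \<tau>\<^sub>2 \<and> dist \<tau>\<^sub>1 \<tau>\<^sub>2 < \<epsilon> \<and>
        (f \<tau>\<^sub>2 - f \<tau>\<^sub>1) / dist \<tau>\<^sub>1 \<tau>\<^sub>2 > lip_seminorm f - \<epsilon>))"

end

theory Submission
  imports Defs
begin

text \<open>
  Call a pair \<open>s \<noteq> t\<close> steep for a function when its difference quotient
  there almost equals the norm. A rank-one operator has the form \<open>T x = \<phi> x *\<^sub>R e\<close> with
  \<open>norm e = 1\<close>, and on \<open>Lip(K)\<close> the Daugavet equation amounts to finding, up to any accuracy, some \<open>H\<close> of norm
  about \<open>1\<close> with \<open>\<phi> H\<close> near \<open>norm T\<close> which shares a steep pair with \<open>e\<close>.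

  Suppose that \<open>K\<close> is local. If \<open>x\<close> and \<open>y\<close> had no approximate midpoint, two
  tents around them, each of slope less than \<open>1\<close> and separated by a gap, would combine to a
  function which attains slope \<open>1\<close> on the pair \<open>(y, x)\<close> but is less steep at all small
  distances (\<open>local_approx_midpoint\<close>). Compactness upgrades approximate midpoints to exact ones,
  and bisection turns them into chains of equal steps along which distances add up. On a chain
  that starts and ends at a very steep pair of \<open>e\<close>, every single step is steep for \<open>e\<close>
  (\<open>steep_chain\<close>). Hence \<open>e\<close> has as many steep pairs as desired, each tiny compared with its
  distance from the others. Take \<open>F\<close> in the unit ball with \<open>\<phi> F\<close> near \<open>norm T\<close>. Near each of
  these pairs \<open>F\<close> can be changed, at almost no cost in norm, so as to have slope \<open>1\<close> there
  (\<open>steepen_near_point\<close>). The changes have disjoint supports, so all their signed sums are bounded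
  by the same constant and \<open>\<phi>\<close> must be small on one of them
  (\<open>functional_small_on_disjoint\<close>). Making just that change gives \<open>H\<close>.

  Conversely suppose that \<open>norm G = 1\<close> and that \<open>G\<close> has no steep pairs at distance below
  \<open>\<epsilon>\<close>. The pairs at distance at least \<open>\<epsilon>\<close> form a compact set, so \<open>G\<close> attains slope exactly \<open>1\<close>,
  and every sufficiently steep pair lies close to one of finitely many pairs on which the slope
  is \<open>1\<close> (\<open>maximal_pairs_finite_net\<close>). Let \<open>\<phi>\<close> be the average of the slopes over these finitely many
  pairs; then \<open>\<phi> G = 1\<close>. The Daugavet equation for \<open>h \<mapsto> \<phi> h *\<^sub>R (- G)\<close> provides \<open>y\<close> of
  norm \<open>1\<close> with \<open>\<phi> y\<close> near \<open>- 1\<close>, so that \<open>y\<close> descends steeply on all the chosen pairs, and with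
  a common steep pair of \<open>y\<close> and \<open>G\<close>. The latter lies near a chosen pair, on which \<open>y\<close> therefore
  ascends: a contradiction (\<open>daugavet_steep_pair\<close>).
\<close>

section \<open>Increments of elements of Lip(K)\<close>

text \<open>Point values are not defined on the quotient by the constants, but increments are, and
  they determine the norm. Working with them avoids choosing representatives.\<close>

lift_definition incr :: "'a::metric_space \<Rightarrow> 'a \<Rightarrow> 'a Lip \<Rightarrow> real" is "\<lambda>s t f. f t - f s"
  by (auto simp: lip_rel_def) (smt (verit))

lemma incr_abs_Lip: "is_lipschitz f \<Longrightarrow> incr s t (abs_Lip f) = f t - f s"
  by (rule incr.abs_eq) (simp add: lip_rel_def)

lemma incr_self [simp]: "incr s s F = 0"
  by transfer simp

lemma incr_trans: "incr s t F + incr t u F = incr s u F"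
  by transfer simp

lemma incr_le: "\<bar>incr s t F\<bar> \<le> norm F * dist s t"
proof -
  obtain f where f: "is_lipschitz f" "F = abs_Lip f" using abs_Lip_surj by blast
  show ?thesis
    using lip_seminorm_bound[OF f(1), of t s]
    by (simp add: f incr_abs_Lip norm_abs_Lip dist_commute)
qed

lemma bounded_linear_incr: "bounded_linear (incr s t)"
proof (rule bounded_linear_intro)
  show "incr s t (F + G) = incr s t F + incr s t G" for F G by transfer simp
  show "incr s t (a *\<^sub>R F) = a *\<^sub>R incr s t F" for a F
    by transfer (simp add: right_diff_distrib)
  show "norm (incr s t F) \<le> norm F * dist s t" for F using incr_le[of s t F] by simp
qed

lemmas incr_linear_simps =
  linear_add[OF bounded_linear.linear[OF bounded_linear_incr]]
  linear_diff[OF bounded_linear.linear[OF bounded_linear_incr]]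
  linear_neg[OF bounded_linear.linear[OF bounded_linear_incr]]
  linear_scale[OF bounded_linear.linear[OF bounded_linear_incr]]
  linear_sum[OF bounded_linear.linear[OF bounded_linear_incr]]

lemma norm_le_incr:
  assumes "0 \<le> C" "\<And>s t. incr s t F \<le> C * dist s t"
  shows "norm F \<le> C"
proof -
  obtain f where f: "is_lipschitz f" "F = abs_Lip f" using abs_Lip_surj by blast
  have "\<bar>f s - f t\<bar> \<le> C * dist s t" for s t
    using assms(2)[of s t] assms(2)[of t s] by (simp add: f incr_abs_Lip dist_commute)
  then show ?thesis
    using lip_seminorm_least[OF assms(1), of f] by (simp add: f norm_abs_Lip)
qed

lemma steep_pair:
  assumes "0 \<le> c" "c < norm F"
  shows "\<exists>s t. s \<noteq> t \<and> c * dist s t < incr s t F"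
proof (rule ccontr)
  assume *: "\<not> ?thesis"
  have "incr s t F \<le> c * dist s t" for s t
    using * incr_le[of s t F] by (cases "s = t") (auto simp: not_less)
  then have "norm F \<le> c" using norm_le_incr[OF assms(1)] by blast
  with assms(2) show False by simp
qed

lemma continuous_on_incr:
  "continuous_on S (\<lambda>x. incr (fst x) (snd x) F)"
proof -
  obtain f where f: "is_lipschitz f" "F = abs_Lip f" using abs_Lip_surj by blast
  have cf: "continuous_on UNIV f"
    using f(1) lipschitz_on_continuous_on unfolding is_lipschitz_def by blast
  have "continuous_on S (\<lambda>x. f (snd x) - f (fst x))"
    by (intro continuous_intros continuous_on_compose2[OF cf]) auto
  then show ?thesis by (simp add: f incr_abs_Lip)
qed

section \<open>Rank-one operators\<close>

lemma blinfun_nearly_attained: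
  fixes A :: "'b::real_normed_vector \<Rightarrow>\<^sub>L 'c::real_normed_vector"
  assumes "0 \<le> c" "c < norm A"
  shows "\<exists>x. norm x = 1 \<and> c < norm (blinfun_apply A x)"
proof (rule ccontr)
  assume *: "\<not> ?thesis"
  have "norm (blinfun_apply A x) \<le> c * norm x" for x
  proof (cases "x = 0")
    case False
    then have "norm (blinfun_apply A (x /\<^sub>R norm x)) \<le> c" using * by (auto simp: not_less)
    then show ?thesis using False by (simp add: blinfun.scaleR_right field_simps)
  qed simp
  then have "norm A \<le> c" using norm_blinfun_bound[OF assms(1)] by blast
  with assms(2) show False by simp
qed

lemma rank_one_form:
  fixes T :: "'b::real_normed_vector \<Rightarrow>\<^sub>L 'c::real_normed_vector"
  assumes "dim (range (blinfun_apply T)) = 1"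
  shows "\<exists>\<phi> e. linear \<phi> \<and> norm e = 1 \<and> (\<forall>x. blinfun_apply T x = \<phi> x *\<^sub>R e)"
proof -
  obtain B where B: "independent B" "range (blinfun_apply T) \<subseteq> span B" "card B = 1"
    using basis_exists[of "range (blinfun_apply T)"] assms by metis
  then obtain b where b: "B = {b}" by (auto simp: card_1_singleton_iff)
  then have "b \<noteq> 0" using B(1) dependent_zero by blast
  define e where "e = b /\<^sub>R norm b"
  have e: "norm e = 1" using \<open>b \<noteq> 0\<close> by (simp add: e_def)
  have "\<exists>c. blinfun_apply T x = c *\<^sub>R e" for x
  proof -
    obtain c where "blinfun_apply T x = c *\<^sub>R b" using B(2) b by (auto simp: span_singleton)
    then have "blinfun_apply T x = (c * norm b) *\<^sub>R e" using \<open>b \<noteq> 0\<close> by (simp add: e_def)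
    then show ?thesis ..
  qed
  then obtain \<phi> where \<phi>: "\<And>x. blinfun_apply T x = \<phi> x *\<^sub>R e" by metis
  have cancel: "c = d" if "c *\<^sub>R e = d *\<^sub>R e" for c d
    using that e by (metis norm_zero scaleR_cancel_right zero_neq_one)
  have "linear \<phi>"
  proof (rule linearI)
    show "\<phi> (x + y) = \<phi> x + \<phi> y" for x y
      by (rule cancel) (simp only: \<phi>[symmetric] scaleR_left_distrib blinfun.add_right)
    show "\<phi> (a *\<^sub>R x) = a *\<^sub>R \<phi> x" for a x
      by (rule cancel) (simp add: \<phi>[symmetric] blinfun.scaleR_right flip: scaleR_scaleR)
  qed
  with \<phi> e show ?thesis by blast
qed

section \<open>Compact local spaces have equally spaced chains\<close>

lemma local_steep_pair:
  assumes "local_metric_space TYPE('a::metric_space)" "0 < \<epsilon>"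
  shows "\<exists>s t :: 'a. s \<noteq> t \<and> dist s t < \<epsilon> \<and> (norm F - \<epsilon>) * dist s t < incr s t F"
proof -
  obtain f where f: "is_lipschitz f" "F = abs_Lip f" using abs_Lip_surj by blast
  obtain s t where "s \<noteq> t" "dist s t < \<epsilon>" "lip_seminorm f - \<epsilon> < (f t - f s) / dist s t"
    using assms f(1) unfolding local_metric_space_def by blast
  then show ?thesis
    by (intro exI[of _ s] exI[of _ t]) (simp add: f incr_abs_Lip norm_abs_Lip pos_less_divide_eq)
qed

text \<open>The function \<open>f\<close> below is a positive tent centred at \<open>x\<close> minus a tent centred at \<open>y\<close>. Each
  tent has height \<open>r / 2\<close> and slope only \<open>1 / (1 + \<eta>)\<close>, so its base is slightly too wide for the
  bases to be disjoint in a space with midpoints. Without an approximate midpoint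
  the bases are separated by a gap. Then no short pair sees both tents, so \<open>f\<close> is
  \<open>1 / (1 + \<eta>)\<close>-Lipschitz at small scale, although it rises by \<open>r\<close> from \<open>y\<close> to \<open>x\<close>.\<close>

lemma local_approx_midpoint:
  fixes x y :: "'a::metric_space"
  assumes loc: "local_metric_space TYPE('a)" and "0 < \<delta>" "x \<noteq> y"
  shows "\<exists>z. dist x z < (1 + \<delta>) * (dist x y / 2) \<and> dist y z < (1 + \<delta>) * (dist x y / 2)"
proof (rule ccontr)
  assume none: "\<not> ?thesis"
  define r where "r = dist x y"
  have r: "0 < r" using \<open>x \<noteq> y\<close> by (simp add: r_def)
  \<comment> \<open>The bound \<open>\<eta> \<le> 1\<close> keeps \<open>y\<close> outside the tent around \<open>x\<close>; \<open>3 * \<eta> \<le> \<delta>\<close> leaves room for a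
    gap of width \<open>\<eta> * r\<close> between the bases.\<close>
  define \<eta> where "\<eta> = min 1 (\<delta> / 3)"
  have \<eta>: "0 < \<eta>" "\<eta> \<le> 1" "3 * \<eta> \<le> \<delta>" using \<open>0 < \<delta>\<close> by (simp_all add: \<eta>_def)
  define R where "R = (1 + \<eta>) * (r / 2)"
  define tent where "tent a z = max 0 (r / 2 - dist a z / (1 + \<eta>))" for a z :: 'a
  have tent_lip: "\<bar>tent a s - tent a t\<bar> \<le> dist s t / (1 + \<eta>)" for a s t
  proof -
    have "\<bar>dist a s - dist a t\<bar> \<le> dist s t" by metric
    then have "\<bar>dist a s - dist a t\<bar> / (1 + \<eta>) \<le> dist s t / (1 + \<eta>)"
      using \<eta>(1) by (intro divide_right_mono) auto
    then have "\<bar>dist a s / (1 + \<eta>) - dist a t / (1 + \<eta>)\<bar> \<le> dist s t / (1 + \<eta>)"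
      using \<eta>(1) by (simp add: diff_divide_distrib[symmetric] abs_divide)
    then show ?thesis unfolding tent_def by linarith
  qed
  have tent_zero: "tent a z = 0" if "R \<le> dist a z" for a z
    using that \<eta>(1) unfolding tent_def R_def by (simp add: field_simps)
  have apart: "\<not> (dist x s < R \<and> dist y t < R)" if "dist s t < \<eta> * r" for s t
  proof
    assume *: "dist x s < R \<and> dist y t < R"
    have "0 < \<eta> * r" using \<eta>(1) r by simp
    moreover have "R + \<eta> * r = (1 + 3 * \<eta>) * (r / 2)" by (simp add: R_def field_simps)
    moreover have "\<dots> \<le> (1 + \<delta>) * (dist x y / 2)"
      using \<eta> r unfolding r_def by (intro mult_right_mono) auto
    moreover have "dist y s \<le> dist y t + dist s t" by metric
    ultimately have "dist x s < (1 + \<delta>) * (dist x y / 2)" "dist y s < (1 + \<delta>) * (dist x y / 2)"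
      using * that by linarith+
    then show False using none by blast
  qed
  define f where "f z = tent x z - tent y z" for z
  have lip: "is_lipschitz f"
    unfolding f_def by (intro is_lipschitz_diff is_lipschitzI[of _ "1 / (1 + \<eta>)"])
      (use tent_lip in simp_all)
  have steep: "1 \<le> norm (abs_Lip f)"
  proof -
    have "R \<le> 2 * (r / 2)" unfolding R_def using \<eta> r by (intro mult_right_mono) auto
    then have "tent y x = 0" "tent x y = 0"
      by (auto simp: r_def dist_commute intro!: tent_zero)
    then have "incr y x (abs_Lip f) = r"
      using r by (simp add: incr_abs_Lip[OF lip]) (simp add: f_def tent_def)
    then have "r \<le> norm (abs_Lip f) * r" using incr_le[of y x "abs_Lip f"] r_def by (simp add: dist_commute)
    then show ?thesis using r by simp
  qed
  have flat: "incr s t (abs_Lip f) \<le> dist s t / (1 + \<eta>)" if st: "dist s t < \<eta> * r" for s t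
  proof -
    have "dist t s < \<eta> * r" "dist s s < \<eta> * r" "dist t t < \<eta> * r"
      using \<eta>(1) r st by (simp_all add: dist_commute)
    with st consider "R \<le> dist x s" "R \<le> dist x t" | "R \<le> dist y s" "R \<le> dist y t"
      using apart[of s t] apart[of t s] apart[of s s] apart[of t t] that
      unfolding not_less[symmetric] by blast
    then show ?thesis
      using tent_lip[of x s t] tent_lip[of y s t]
      by cases (auto simp: incr_abs_Lip[OF lip] f_def tent_zero)
  qed
  define \<epsilon> where "\<epsilon> = min (\<eta> * r) (\<eta> / (1 + \<eta>))"
  have "0 < \<epsilon>" using \<eta> r by (simp add: \<epsilon>_def)
  then obtain s t where st: "s \<noteq> t" "dist s t < \<epsilon>" "(norm (abs_Lip f) - \<epsilon>) * dist s t < incr s t (abs_Lip f)"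
    using local_steep_pair[OF loc] by blast
  have "dist s t / (1 + \<eta>) = (1 - \<eta> / (1 + \<eta>)) * dist s t"
    using \<eta>(1) by (simp add: field_simps)
  also have "\<dots> \<le> (norm (abs_Lip f) - \<epsilon>) * dist s t"
    using steep by (intro mult_right_mono) (auto simp: \<epsilon>_def)
  also have "\<dots> < dist s t / (1 + \<eta>)" using flat[of s t] st by (simp add: \<epsilon>_def)
  finally show False by simp
qed

lemma compact_local_midpoint:
  fixes x y :: "'a::metric_space"
  assumes "compact (UNIV :: 'a set)" "local_metric_space TYPE('a)"
  shows "\<exists>z. dist x z = dist x y / 2 \<and> dist z y = dist x y / 2"
proof (cases "x = y")
  case False
  \<comment> \<open>A point minimising the larger of its distances to \<open>x\<close> and \<open>y\<close>.\<close>
  have "continuous_on UNIV (\<lambda>z. max (dist x z) (dist y z))" by (intro continuous_intros)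
  then obtain z where z: "\<And>w. max (dist x z) (dist y z) \<le> max (dist x w) (dist y w)"
    using continuous_attains_inf[OF assms(1)] by blast
  have "max (dist x z) (dist y z) \<le> dist x y / 2"
  proof (rule ccontr)
    assume "\<not> ?thesis"
    then have less: "dist x y / 2 < max (dist x z) (dist y z)" by simp
    define \<delta> where "\<delta> = max (dist x z) (dist y z) / (dist x y / 2) - 1"
    have "0 < \<delta>" "(1 + \<delta>) * (dist x y / 2) = max (dist x z) (dist y z)"
      using less False by (simp_all add: \<delta>_def)
    then obtain w where "max (dist x w) (dist y w) < max (dist x z) (dist y z)"
      using local_approx_midpoint[OF assms(2) _ False] by fastforce
    then show False using z[of w] by linarith
  qed
  moreover have "dist x y \<le> dist x z + dist y z" by metric
  ultimately show ?thesis by (intro exI[of _ z]) (auto simp: dist_commute)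
qed auto

lemma dyadic_chain:
  fixes x y :: "'a::metric_space"
  assumes mid: "\<And>x y :: 'a. \<exists>z. dist x z = dist x y / 2 \<and> dist z y = dist x y / 2"
  shows "\<exists>z. z 0 = x \<and> z (2 ^ k) = y \<and> (\<forall>i<2 ^ k. dist (z i) (z (Suc i)) = dist x y / 2 ^ k)"
proof (induction k arbitrary: x y)
  case 0
  show ?case by (rule exI[of _ "\<lambda>i. if i = 0 then x else y"]) simp
next
  case (Suc k)
  obtain m where m: "dist x m = dist x y / 2" "dist m y = dist x y / 2" using mid by blast
  obtain u where u: "u 0 = x" "u (2 ^ k) = m"
    "\<And>i. i < 2 ^ k \<Longrightarrow> dist (u i) (u (Suc i)) = dist x m / 2 ^ k"
    using Suc.IH by blast
  obtain v where v: "v 0 = m" "v (2 ^ k) = y"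
    "\<And>i. i < 2 ^ k \<Longrightarrow> dist (v i) (v (Suc i)) = dist m y / 2 ^ k"
    using Suc.IH by blast
  define z where "z i = (if i \<le> 2 ^ k then u i else v (i - 2 ^ k))" for i
  have "dist (z i) (z (Suc i)) = dist x y / 2 ^ Suc k" if "i < 2 ^ Suc k" for i
  proof -
    consider "i < 2 ^ k" | "i = 2 ^ k" | "2 ^ k < i" by linarith
    then show ?thesis
    proof cases
      case 1
      then show ?thesis using u(3)[of i] m by (simp add: z_def)
    next
      case 2
      then show ?thesis using u(2) v(1) v(3)[of 0] m by (simp add: z_def)
    next
      case 3
      then show ?thesis
        using v(3)[of "i - 2 ^ k"] m that by (simp add: z_def Suc_diff_le)
    qed
  qed
  moreover have "z 0 = x" "z (2 ^ Suc k) = y" using u v by (simp_all add: z_def)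
  ultimately show ?case by blast
qed

text \<open>Used for the upper bounds on distances in a chain; when the end points of the chain are as
  far apart as the steps allow, these bounds are equalities.\<close>

lemma chain_dist_le:
  fixes z :: "nat \<Rightarrow> 'a::metric_space"
  assumes "\<And>i. i < n \<Longrightarrow> dist (z i) (z (Suc i)) \<le> d" "i \<le> j" "j \<le> n"
  shows "dist (z i) (z j) \<le> real (j - i) * d"
  using assms(2,3)
proof (induction j rule: dec_induct)
  case (step j)
  have "dist (z i) (z (Suc j)) \<le> dist (z i) (z j) + dist (z j) (z (Suc j))" by metric
  also have "\<dots> \<le> real (j - i) * d + d" using step assms(1)[of j] by (intro add_mono) auto
  also have "\<dots> = real (Suc j - i) * d" using step by (simp add: Suc_diff_le algebra_simps)
  finally show ?case .
qed simp

lemma incr_chain: "incr (z 0) (z n) F = (\<Sum>i<n. incr (z i) (z (Suc i)) F)"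
proof (induction n)
  case (Suc n)
  then show ?case using incr_trans[of "z 0" "z n" F "z (Suc n)"] by simp
qed simp

text \<open>On a chain of \<open>n\<close> equal steps of length \<open>d\<close> every increment is at most \<open>norm F * d\<close>. If the
  total increment falls short of \<open>n * norm F * d\<close> by at most \<open>\<epsilon> * d\<close>, then no single step can
  fall short by more. So it suffices to start from a pair whose slope is within
  \<open>\<epsilon> / n\<close> of the norm; this is possible because \<open>n\<close> is fixed before the pair.\<close>

lemma steep_chain:
  fixes F :: "'a::metric_space Lip" and k :: nat
  assumes mid: "\<And>x y :: 'a. \<exists>z. dist x z = dist x y / 2 \<and> dist z y = dist x y / 2"
    and "0 < \<epsilon>" "\<epsilon> \<le> norm F"
  shows "\<exists>z d. 0 < d
    \<and> (\<forall>i j. i \<le> j \<longrightarrow> j \<le> 2 ^ k \<longrightarrow> dist (z i) (z j) = real (j - i) * d)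
    \<and> (\<forall>i<2 ^ k. (norm F - \<epsilon>) * d \<le> incr (z i) (z (Suc i)) F)"
proof -
  define n :: nat where "n = 2 ^ k"
  have n: "0 < n" "real n = 2 ^ k" by (simp_all add: n_def)
  have "0 < norm F" using assms by linarith
  have "\<epsilon> / n \<le> \<epsilon>" using n \<open>0 < \<epsilon>\<close> by (simp add: divide_le_eq Suc_leI)
  then obtain x y where xy: "x \<noteq> y" "(norm F - \<epsilon> / n) * dist x y < incr x y F"
    using steep_pair[of "norm F - \<epsilon> / n" F] assms n by auto
  obtain z where z: "z 0 = x" "z n = y" "\<And>i. i < n \<Longrightarrow> dist (z i) (z (Suc i)) = dist x y / n"
    using dyadic_chain[OF mid, where x=x and y=y and k=k] n unfolding n_def by auto
  define d where "d = dist x y / n"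
  have d: "0 < d" "dist x y = n * d" using xy n by (simp_all add: d_def)
  have step: "dist (z i) (z (Suc i)) = d" if "i < n" for i using z(3) that by (simp add: d_def)
  have le: "dist (z i) (z j) \<le> real (j - i) * d" if "i \<le> j" "j \<le> n" for i j
    using chain_dist_le[of n z d i j] step that by simp
  have eq: "dist (z i) (z j) = real (j - i) * d" if ij: "i \<le> j" "j \<le> n" for i j
  proof -
    have "n * d \<le> dist (z 0) (z i) + dist (z i) (z j) + dist (z j) (z n)"
      unfolding d(2)[symmetric] z(1)[symmetric] z(2)[symmetric] by metric
    also have "\<dots> \<le> i * d + dist (z i) (z j) + real (n - j) * d"
      using le[of 0 i] le[of j n] ij by simp
    finally have "real (j - i) * d \<le> dist (z i) (z j)"
      using ij by (simp add: of_nat_diff algebra_simps)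
    with le[OF ij] show ?thesis by simp
  qed
  have "(norm F - \<epsilon>) * d \<le> incr (z i) (z (Suc i)) F" if "i < n" for i
  proof -
    have "(norm F - \<epsilon> / n) * (n * d) \<le> (\<Sum>j<n. incr (z j) (z (Suc j)) F)"
      using xy(2) d(2) z incr_chain[of z n F] by simp
    also have "\<dots> = incr (z i) (z (Suc i)) F + (\<Sum>j\<in>{..<n} - {i}. incr (z j) (z (Suc j)) F)"
      using that by (simp add: sum.remove[of "{..<n}" i])
    also have "(\<Sum>j\<in>{..<n} - {i}. incr (z j) (z (Suc j)) F) \<le> real (card ({..<n} - {i})) * (norm F * d)"
    proof (rule sum_bounded_above)
      fix j assume "j \<in> {..<n} - {i}"
      then show "incr (z j) (z (Suc j)) F \<le> norm F * d"
        using incr_le[of "z j" "z (Suc j)" F] step by simp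
    qed
    also have "real (card ({..<n} - {i})) = real n - 1" using that by (simp add: of_nat_diff Suc_leI)
    finally have "(norm F - \<epsilon> / n) * (n * d) \<le> incr (z i) (z (Suc i)) F + (real n - 1) * (norm F * d)"
      by linarith
    moreover have "(norm F - \<epsilon> / n) * (n * d) = n * (norm F * d) - \<epsilon> * d"
      using n(1) by (simp add: field_simps)
    ultimately show ?thesis by (simp add: algebra_simps)
  qed
  with d eq show ?thesis unfolding n_def by blast
qed

section \<open>Perturbations with disjoint supports\<close>

text \<open>The new function is the maximum of \<open>f\<close> and a cone of slope \<open>1 + \<epsilon>\<close> with apex
  over \<open>q\<close> at height \<open>f p + dist p q\<close>. The apex exceeds \<open>f q\<close> by at most \<open>2 * dist p q\<close>, while
  away from \<open>q\<close> the cone falls faster than the \<open>1\<close>-Lipschitz \<open>f\<close> can, by at least \<open>\<epsilon>\<close> per unit of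
  distance. So it has sunk to \<open>f\<close> or below outside the ball of radius \<open>R\<close> around \<open>p\<close>.\<close>

lemma steepen_near_point:
  fixes F :: "'a::metric_space Lip"
  assumes F: "norm F \<le> 1" and "0 < \<epsilon>" and R: "2 * dist p q \<le> \<epsilon> * (R - dist p q)"
  shows "\<exists>u. (\<forall>s t. \<bar>u s - u t\<bar> \<le> (2 + \<epsilon>) * dist s t) \<and> (\<forall>t. R \<le> dist p t \<longrightarrow> u t = 0)
    \<and> norm (F + abs_Lip u) \<le> 1 + \<epsilon> \<and> incr p q (F + abs_Lip u) = dist p q"
proof -
  obtain f where f: "is_lipschitz f" "F = abs_Lip f" using abs_Lip_surj by blast
  have f1: "\<bar>f s - f t\<bar> \<le> dist s t" for s t
  proof -
    have "\<bar>f s - f t\<bar> \<le> norm F * dist s t"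
      using lip_seminorm_bound[OF f(1)] f norm_abs_Lip by metis
    also have "\<dots> \<le> 1 * dist s t" using F by (intro mult_right_mono) auto
    finally show ?thesis by simp
  qed
  define h where "h t = max (f t) (f p + dist p q - (1 + \<epsilon>) * dist q t)" for t
  have h_lip: "\<bar>h s - h t\<bar> \<le> (1 + \<epsilon>) * dist s t" for s t
  proof -
    have "\<bar>dist q s - dist q t\<bar> \<le> dist s t" by metric
    then have "(1 + \<epsilon>) * \<bar>dist q s - dist q t\<bar> \<le> (1 + \<epsilon>) * dist s t"
      using \<open>0 < \<epsilon>\<close> by (intro mult_left_mono) auto
    then have "\<bar>(1 + \<epsilon>) * dist q s - (1 + \<epsilon>) * dist q t\<bar> \<le> (1 + \<epsilon>) * dist s t"
      using \<open>0 < \<epsilon>\<close> by (simp add: right_diff_distrib[symmetric] abs_mult)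
    moreover have "dist s t \<le> (1 + \<epsilon>) * dist s t" using \<open>0 < \<epsilon>\<close> by (simp add: distrib_right)
    ultimately show ?thesis using f1[of s t] unfolding h_def by linarith
  qed
  have hL: "is_lipschitz h" by (rule is_lipschitzI[OF h_lip])
  have h_out: "h t = f t" if "R \<le> dist p t" for t
  proof -
    have "R - dist p q \<le> dist q t" using that by metric
    then have "\<epsilon> * (R - dist p q) \<le> \<epsilon> * dist q t" using \<open>0 < \<epsilon>\<close> by (intro mult_left_mono) auto
    moreover have "f p - f t \<le> dist p q + dist q t"
      using f1[of p t] dist_triangle[of p t q] by linarith
    ultimately show ?thesis using R by (simp add: h_def algebra_simps)
  qed
  have hpq: "h p = f p" "h q = f p + dist p q"
    using f1[of p q] \<open>0 < \<epsilon>\<close> by (simp_all add: h_def dist_commute algebra_simps)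
  define u where "u t = h t - f t" for t
  have uL: "is_lipschitz u" unfolding u_def by (rule is_lipschitz_diff[OF hL f(1)])
  have "abs_Lip u = abs_Lip h - abs_Lip f"
    using abs_Lip_diff[OF hL f(1)] by (simp add: u_def[abs_def])
  then have Fu: "F + abs_Lip u = abs_Lip h" by (simp add: f)
  have "\<bar>u s - u t\<bar> \<le> (2 + \<epsilon>) * dist s t" for s t
    using h_lip[of s t] f1[of s t] by (simp add: u_def algebra_simps)
  moreover have "norm (abs_Lip h) \<le> 1 + \<epsilon>"
    using h_lip \<open>0 < \<epsilon>\<close> lip_seminorm_least[of "1 + \<epsilon>" h] by (simp add: norm_abs_Lip[OF hL])
  ultimately show ?thesis
    using h_out hpq Fu by (intro exI[of _ u]) (simp add: u_def incr_abs_Lip[OF hL])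
qed

text \<open>For given \<open>s\<close> and \<open>t\<close> at most one summand is nonzero at \<open>s\<close> and at most one at \<open>t\<close>, whence
  the factor \<open>2\<close>, whatever the number of summands.\<close>

lemma norm_signed_disjoint_sum:
  fixes u :: "'i \<Rightarrow> 'a::metric_space \<Rightarrow> real"
  assumes "finite J" and lip: "\<And>j s t. j \<in> J \<Longrightarrow> \<bar>u j s - u j t\<bar> \<le> L * dist s t"
    and disj: "\<And>i j t. i \<in> J \<Longrightarrow> j \<in> J \<Longrightarrow> i \<noteq> j \<Longrightarrow> u i t = 0 \<or> u j t = 0"
    and \<theta>: "\<And>j. \<bar>\<theta> j\<bar> \<le> 1" and "0 \<le> L"
  shows "norm (\<Sum>j\<in>J. \<theta> j *\<^sub>R abs_Lip (u j)) \<le> 2 * L"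
proof (rule norm_le_incr)
  fix s t
  define S where "S w = {j \<in> J. u j w \<noteq> 0}" for w
  have card1: "card (S w) \<le> 1" for w
    using disj \<open>finite J\<close> by (subst card_le_Suc0_iff_eq[unfolded One_nat_def[symmetric]]) (auto simp: S_def)
  have "card (S s \<union> S t) \<le> 2"
    using card_Un_le[of "S s" "S t"] card1[of s] card1[of t] by linarith
  have term_le: "\<theta> j * (u j t - u j s) \<le> L * dist s t" if "j \<in> J" for j
  proof -
    have "\<theta> j * (u j t - u j s) \<le> \<bar>\<theta> j\<bar> * \<bar>u j t - u j s\<bar>" by (metis abs_ge_self abs_mult)
    also have "\<dots> \<le> 1 * (L * dist s t)"
      using lip[OF that, of t s] \<theta>[of j] by (intro mult_mono) (auto simp: dist_commute)
    finally show ?thesis by simp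
  qed
  have "incr s t (\<Sum>j\<in>J. \<theta> j *\<^sub>R abs_Lip (u j)) = (\<Sum>j\<in>J. \<theta> j * (u j t - u j s))"
    by (auto simp: incr_linear_simps incr_abs_Lip is_lipschitzI[OF lip] intro!: sum.cong)
  also have "\<dots> = (\<Sum>j\<in>S s \<union> S t. \<theta> j * (u j t - u j s))"
    by (rule sum.mono_neutral_right) (auto simp: S_def \<open>finite J\<close>)
  also have "\<dots> \<le> real (card (S s \<union> S t)) * (L * dist s t)"
    by (rule sum_bounded_above) (use term_le in \<open>auto simp: S_def\<close>)
  also have "\<dots> \<le> 2 * (L * dist s t)"
    using \<open>card (S s \<union> S t) \<le> 2\<close> \<open>0 \<le> L\<close> by (intro mult_right_mono) auto
  finally show "incr s t (\<Sum>j\<in>J. \<theta> j *\<^sub>R abs_Lip (u j)) \<le> 2 * L * dist s t" by simp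
qed (use \<open>0 \<le> L\<close> in simp)

text \<open>With signs chosen to make every term nonnegative, the absolute values of \<open>\<phi>\<close> on the
  summands add up to its value on a signed sum, whose norm does not grow with the number of
  summands. So not all of them can be large.\<close>

lemma functional_small_on_disjoint:
  fixes u :: "'i \<Rightarrow> 'a::metric_space \<Rightarrow> real" and \<epsilon> :: real and \<phi> :: "'a Lip \<Rightarrow> real"
  assumes "finite J" and lip: "\<And>j s t. j \<in> J \<Longrightarrow> \<bar>u j s - u j t\<bar> \<le> L * dist s t"
    and disj: "\<And>i j t. i \<in> J \<Longrightarrow> j \<in> J \<Longrightarrow> i \<noteq> j \<Longrightarrow> u i t = 0 \<or> u j t = 0"
    and "0 \<le> L" and \<phi>: "linear \<phi>" "\<And>F. \<bar>\<phi> F\<bar> \<le> c * norm F" and "0 \<le> c"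
    and small: "2 * L * c < \<epsilon> * real (card J)"
  shows "\<exists>j\<in>J. \<bar>\<phi> (abs_Lip (u j))\<bar> < \<epsilon>"
proof (rule ccontr)
  assume "\<not> ?thesis"
  then have ge: "\<epsilon> \<le> \<bar>\<phi> (abs_Lip (u j))\<bar>" if "j \<in> J" for j using that by force
  define \<theta> where "\<theta> j = sgn (\<phi> (abs_Lip (u j)))" for j
  have "\<epsilon> * real (card J) \<le> (\<Sum>j\<in>J. \<bar>\<phi> (abs_Lip (u j))\<bar>)"
    using sum_bounded_below[OF ge] by (simp add: mult.commute)
  also have "\<dots> = (\<Sum>j\<in>J. \<theta> j * \<phi> (abs_Lip (u j)))" by (simp add: \<theta>_def abs_sgn mult.commute)
  also have "\<dots> = \<phi> (\<Sum>j\<in>J. \<theta> j *\<^sub>R abs_Lip (u j))"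
    by (simp add: linear_sum[OF \<phi>(1)] linear_scale[OF \<phi>(1)])
  also have "\<dots> \<le> c * norm (\<Sum>j\<in>J. \<theta> j *\<^sub>R abs_Lip (u j))" using \<phi>(2) abs_le_D1 by blast
  also have "\<dots> \<le> c * (2 * L)"
    using assms by (intro mult_left_mono norm_signed_disjoint_sum) (auto simp: \<theta>_def abs_sgn_eq)
  finally show False using small by (simp add: mult.commute mult.left_commute)
qed

section \<open>Locality implies the Daugavet property\<close>

text \<open>A chain of \<open>2 ^ a\<close> blocks of \<open>2 ^ b\<close> steps each supplies, as the first step of each block,
  \<open>2 ^ a\<close> steep pairs of \<open>e\<close>. The exponent \<open>a\<close> makes the blocks numerous enough for \<open>\<phi>\<close> to be
  small on one of the perturbations, and \<open>b\<close> makes a step so short compared with the radius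
  \<open>R\<close>, half the length of a block, that each perturbation fits into a ball of this radius.\<close>

lemma steepen_preserving_functional:
  fixes F e :: "'a::metric_space Lip"
  assumes mid: "\<And>x y :: 'a. \<exists>z. dist x z = dist x y / 2 \<and> dist z y = dist x y / 2"
    and F: "norm F \<le> 1" and e: "norm e = 1" and \<epsilon>: "0 < \<epsilon>" "\<epsilon> \<le> 1"
    and \<phi>: "linear \<phi>" "\<And>F. \<bar>\<phi> F\<bar> \<le> c * norm F" and "0 \<le> c"
  shows "\<exists>H p q. p \<noteq> q \<and> norm H \<le> 1 + \<epsilon> \<and> \<bar>\<phi> H - \<phi> F\<bar> < \<epsilon>
    \<and> incr p q H = dist p q \<and> (1 - \<epsilon>) * dist p q \<le> incr p q e"
proof -
  obtain a where a: "2 * (2 + \<epsilon>) * c / \<epsilon> < 2 ^ a" using real_arch_pow[of 2] by auto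
  obtain b where b: "2 + 4 / \<epsilon> < 2 ^ b" using real_arch_pow[of 2] by auto
  define M :: nat where "M = 2 ^ b"
  obtain z d where d: "0 < d"
    and z: "\<And>i j. i \<le> j \<Longrightarrow> j \<le> 2 ^ (a + b) \<Longrightarrow> dist (z i) (z j) = real (j - i) * d"
    and steep: "\<And>i. i < 2 ^ (a + b) \<Longrightarrow> (norm e - \<epsilon>) * d \<le> incr (z i) (z (Suc i)) e"
    using steep_chain[OF mid, of \<epsilon> e "a + b"] \<epsilon> e by auto
  define J where "J = {..<(2::nat) ^ a}"
  have M: "0 < M" "4 < \<epsilon> * (real M - 2)" using b \<epsilon> by (simp_all add: M_def field_simps)
  have JM: "j * M < 2 ^ (a + b)" if "j \<in> J" for j using that by (simp add: J_def M_def power_add)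
  have pq: "dist (z (j * M)) (z (Suc (j * M))) = d" if "j \<in> J" for j
    using z[of "j * M" "Suc (j * M)"] JM[OF that] by simp
  define R where "R = M * d / 2"
  have R: "2 * d \<le> \<epsilon> * (R - d)"
  proof -
    have "4 * d \<le> \<epsilon> * (real M - 2) * d" using M(2) d by (intro mult_right_mono) auto
    then show ?thesis by (simp add: R_def algebra_simps)
  qed
  have "\<forall>j\<in>J. \<exists>u. (\<forall>s t. \<bar>u s - u t\<bar> \<le> (2 + \<epsilon>) * dist s t)
      \<and> (\<forall>t. R \<le> dist (z (j * M)) t \<longrightarrow> u t = 0) \<and> norm (F + abs_Lip u) \<le> 1 + \<epsilon>
      \<and> incr (z (j * M)) (z (Suc (j * M))) (F + abs_Lip u) = d"
    using steepen_near_point[OF F \<epsilon>(1)] pq R by metis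
  then obtain u where u_lip: "\<And>j s t. j \<in> J \<Longrightarrow> \<bar>u j s - u j t\<bar> \<le> (2 + \<epsilon>) * dist s t"
    and u_supp: "\<And>j t. j \<in> J \<Longrightarrow> R \<le> dist (z (j * M)) t \<Longrightarrow> u j t = 0"
    and u_norm: "\<And>j. j \<in> J \<Longrightarrow> norm (F + abs_Lip (u j)) \<le> 1 + \<epsilon>"
    and u_incr: "\<And>j. j \<in> J \<Longrightarrow> incr (z (j * M)) (z (Suc (j * M))) (F + abs_Lip (u j)) = d"
    by metis
  have far: "2 * R \<le> dist (z (i * M)) (z (j * M))" if "i < j" "j \<in> J" for i j
  proof -
    have "1 * M \<le> (j - i) * M" using that by (intro mult_le_mono1) simp
    then have "real M \<le> real ((j - i) * M)" by (simp only: of_nat_le_iff mult_1)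
    then have "real M * d \<le> real ((j - i) * M) * d" using d by (intro mult_right_mono) auto
    also have "(j - i) * M = j * M - i * M" by (rule diff_mult_distrib)
    also have "real (j * M - i * M) * d = dist (z (i * M)) (z (j * M))"
      using z[of "i * M" "j * M"] JM[OF that(2)] that(1) by simp
    finally show ?thesis by (simp add: R_def)
  qed
  have disj: "u i t = 0 \<or> u j t = 0" if ij: "i \<in> J" "j \<in> J" "i \<noteq> j" for i j t
  proof (rule ccontr)
    assume "\<not> ?thesis"
    then have "dist (z (i * M)) t < R" "dist (z (j * M)) t < R"
      using u_supp ij by (meson not_less)+
    then have "dist (z (i * M)) (z (j * M)) < 2 * R" by metric
    then show False using far[of i j] far[of j i] ij by (auto simp: dist_commute neq_iff)
  qed
  have "2 * (2 + \<epsilon>) * c < \<epsilon> * card J" using a \<epsilon> by (simp add: J_def field_simps)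
  then obtain j where j: "j \<in> J" "\<bar>\<phi> (abs_Lip (u j))\<bar> < \<epsilon>"
    using functional_small_on_disjoint[of J u "2 + \<epsilon>" \<phi> c \<epsilon>] u_lip disj \<phi> \<open>0 \<le> c\<close> \<epsilon>
    by (auto simp: J_def)
  show ?thesis
  proof (intro exI conjI)
    show "z (j * M) \<noteq> z (Suc (j * M))" using pq[OF j(1)] d by auto
    show "norm (F + abs_Lip (u j)) \<le> 1 + \<epsilon>" by (rule u_norm[OF j(1)])
    show "\<bar>\<phi> (F + abs_Lip (u j)) - \<phi> F\<bar> < \<epsilon>" using j(2) by (simp add: linear_add[OF \<phi>(1)])
    show "incr (z (j * M)) (z (Suc (j * M))) (F + abs_Lip (u j)) = dist (z (j * M)) (z (Suc (j * M)))"
      using u_incr[OF j(1)] pq[OF j(1)] by simp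
    show "(1 - \<epsilon>) * dist (z (j * M)) (z (Suc (j * M))) \<le> incr (z (j * M)) (z (Suc (j * M))) e"
      using steep[OF JM[OF j(1)]] pq[OF j(1)] e by simp
  qed
qed

text \<open>If \<open>\<phi> H\<close> is near \<open>norm T\<close> and \<open>H\<close> has slope \<open>1\<close> on a steep pair of \<open>e\<close>, then
  \<open>H + T H = H + \<phi> H *\<^sub>R e\<close> has slope near \<open>1 + norm T\<close> there.\<close>

lemma midpoints_imp_daugavet:
  assumes mid: "\<And>x y :: 'a::metric_space. \<exists>z. dist x z = dist x y / 2 \<and> dist z y = dist x y / 2"
  shows "daugavet_property TYPE('a Lip)"
  unfolding daugavet_property_def
proof (intro allI impI)
  fix T :: "'a Lip \<Rightarrow>\<^sub>L 'a Lip"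
  assume "dim (range (blinfun_apply T)) = 1"
  then obtain \<phi> e where \<phi>: "linear \<phi>" and e: "norm e = 1"
    and T: "\<And>x. blinfun_apply T x = \<phi> x *\<^sub>R e"
    using rank_one_form by blast
  define c where "c = norm T"
  have abs_\<phi>: "\<bar>\<phi> x\<bar> = norm (blinfun_apply T x)" for x by (simp add: T e)
  have \<phi>_le: "\<bar>\<phi> x\<bar> \<le> c * norm x" for x using norm_blinfun[of T x] by (simp add: abs_\<phi> c_def)
  have "\<phi> \<noteq> (\<lambda>_. 0)"
  proof
    assume "\<phi> = (\<lambda>_. 0)"
    then have "range (blinfun_apply T) = {0}" by (auto simp: T)
    then have "dim (range (blinfun_apply T)) \<le> 0"
      using real_vector.dim_le_card[of "range (blinfun_apply T)" "{}"] by simp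
    with \<open>dim (range (blinfun_apply T)) = 1\<close> show False by simp
  qed
  then have "T \<noteq> 0" using abs_\<phi> by auto
  then have "0 < c" by (simp add: c_def)
  have key: "1 + (c - 2 * \<epsilon>) * (1 - \<epsilon>) \<le> norm (id_blinfun + T) * (1 + \<epsilon>)"
    if \<epsilon>: "0 < \<epsilon>" "\<epsilon> < 1" "2 * \<epsilon> < c" for \<epsilon>
  proof -
    obtain F0 where F0: "norm F0 = 1" "c - \<epsilon> < norm (blinfun_apply T F0)"
      using blinfun_nearly_attained[of "c - \<epsilon>" T] \<epsilon> by (auto simp: c_def)
    define F where "F = sgn (\<phi> F0) *\<^sub>R F0"
    have F: "norm F \<le> 1" "c - \<epsilon> < \<phi> F"
      using F0 by (simp_all add: F_def abs_\<phi>[symmetric] linear_scale[OF \<phi>] abs_sgn_eq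
          abs_sgn mult.commute)
    obtain H p q where H: "p \<noteq> q" "norm H \<le> 1 + \<epsilon>" "\<bar>\<phi> H - \<phi> F\<bar> < \<epsilon>"
      "incr p q H = dist p q" "(1 - \<epsilon>) * dist p q \<le> incr p q e"
      using steepen_preserving_functional[OF mid F(1) e \<epsilon>(1) _ \<phi> \<phi>_le] \<epsilon> \<open>0 < c\<close> by auto
    have "(c - 2 * \<epsilon>) * ((1 - \<epsilon>) * dist p q) \<le> \<phi> H * incr p q e"
      using H F \<epsilon> by (intro mult_mono) auto
    then have "(1 + (c - 2 * \<epsilon>) * (1 - \<epsilon>)) * dist p q \<le> incr p q (H + \<phi> H *\<^sub>R e)"
      by (simp add: incr_linear_simps H(4) distrib_right mult.assoc)
    also have "\<dots> \<le> norm (H + \<phi> H *\<^sub>R e) * dist p q" using incr_le abs_le_D1 by blast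
    finally have "1 + (c - 2 * \<epsilon>) * (1 - \<epsilon>) \<le> norm (blinfun_apply (id_blinfun + T) H)"
      using H(1) by (simp add: blinfun.add_left T)
    also have "\<dots> \<le> norm (id_blinfun + T) * norm H" by (rule norm_blinfun)
    also have "\<dots> \<le> norm (id_blinfun + T) * (1 + \<epsilon>)" using H by (intro mult_left_mono) auto
    finally show ?thesis .
  qed
  have "1 + c \<le> norm (id_blinfun + T)"
  proof (rule tendsto_le)
    show "((\<lambda>\<epsilon>. norm (id_blinfun + T) * (1 + \<epsilon>)) \<longlongrightarrow> norm (id_blinfun + T)) (at_right 0)"
      by (auto intro!: tendsto_eq_intros)
    show "((\<lambda>\<epsilon>. 1 + (c - 2 * \<epsilon>) * (1 - \<epsilon>)) \<longlongrightarrow> 1 + c) (at_right 0)"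
      by (auto intro!: tendsto_eq_intros)
    have "0 < min 1 (c / 2)" using \<open>0 < c\<close> by simp
    then show "\<forall>\<^sub>F \<epsilon> in at_right 0. 1 + (c - 2 * \<epsilon>) * (1 - \<epsilon>) \<le> norm (id_blinfun + T) * (1 + \<epsilon>)"
      unfolding eventually_at_right_field using key by (intro exI[of _ "min 1 (c / 2)"]) auto
  qed simp
  moreover have "norm (id_blinfun + T) \<le> 1 + norm T"
    using norm_triangle_ineq[of id_blinfun T] norm_blinfun_id_le[where ?'a = "'a Lip"] by linarith
  ultimately show "norm (id_blinfun + T) = 1 + norm T" by (simp add: c_def)
qed

section \<open>The Daugavet property implies locality\<close>

text \<open>Take a finite net of the compact set of pairs where the slope of \<open>G\<close> is exactly \<open>1\<close>. Off
  its neighbourhood the slope is a continuous function below \<open>1\<close> on a compact set, hence bounded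
  away from \<open>1\<close>; \<open>\<theta>\<close> is the resulting gap. It matters that the net consists of pairs of
  exact slope \<open>1\<close>: its size is then fixed before any degree of steepness has to be chosen.\<close>

lemma maximal_pairs_finite_net:
  fixes G :: "'a::metric_space Lip"
  assumes comp: "compact (UNIV :: 'a set)" and G: "norm G = 1" and \<epsilon>: "0 < \<epsilon>"
  shows "\<exists>k \<theta>. finite k \<and> 0 < \<theta> \<and> (\<forall>(s, t)\<in>k. s \<noteq> t \<and> incr s t G = dist s t)
    \<and> (\<forall>s t. \<epsilon> \<le> dist s t \<longrightarrow> (1 - \<theta>) * dist s t < incr s t G \<longrightarrow>
        (\<exists>(s', t')\<in>k. dist s s' < \<epsilon> / 4 \<and> dist t t' < \<epsilon> / 4))"
proof -
  let ?inc = "\<lambda>x. incr (fst x) (snd x) G" and ?d = "\<lambda>x::'a \<times> 'a. dist (fst x) (snd x)"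
  have U: "compact (UNIV :: ('a \<times> 'a) set)" using compact_Times[OF comp comp] by simp
  define D where "D = {x. \<epsilon> \<le> ?d x}"
  define \<Gamma> where "\<Gamma> = D \<inter> {x. ?inc x = ?d x}"
  have ci: "continuous_on S ?inc" for S by (rule continuous_on_incr)
  have "closed D" unfolding D_def by (intro closed_Collect_le continuous_intros)
  moreover have "closed {x. ?inc x = ?d x}" by (intro closed_Collect_eq ci continuous_intros)
  ultimately have "compact \<Gamma>" "compact D"
    using compact_Int_closed[OF U, of D] compact_Int_closed[OF U, of \<Gamma>] by (auto simp: \<Gamma>_def)
  obtain k where k: "k \<subseteq> \<Gamma>" "finite k" "\<Gamma> \<subseteq> (\<Union>x\<in>k. ball x (\<epsilon> / 4))"
    using compactE_image[OF \<open>compact \<Gamma>\<close>, of \<Gamma> "\<lambda>x. ball x (\<epsilon> / 4)"] \<epsilon> by force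
  define C where "C = D - (\<Union>x\<in>k. ball x (\<epsilon> / 4))"
  have "compact C" unfolding C_def using \<open>compact D\<close> by (intro compact_diff) auto
  have "\<exists>\<theta>>0. \<forall>x\<in>C. ?inc x \<le> (1 - \<theta>) * ?d x"
  proof (cases "C = {}")
    case True
    then show ?thesis using zero_less_one by blast
  next
    case False
    have pos: "0 < ?d x" if "x \<in> C" for x using that \<epsilon> by (auto simp: C_def D_def)
    have "continuous_on C (\<lambda>x. ?inc x / ?d x)"
      using pos by (intro continuous_intros ci) force
    then obtain m where m: "m \<in> C" "\<And>x. x \<in> C \<Longrightarrow> ?inc x / ?d x \<le> ?inc m / ?d m"
      using continuous_attains_sup[OF \<open>compact C\<close> False] by blast
    have "m \<notin> \<Gamma>" "m \<in> D" using m k by (auto simp: C_def)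
    then have "?inc m < ?d m" using incr_le[of "fst m" "snd m" G] G by (auto simp: \<Gamma>_def)
    then have "0 < 1 - ?inc m / ?d m" using pos[OF m(1)] by simp
    moreover have "?inc x \<le> (1 - (1 - ?inc m / ?d m)) * ?d x" if "x \<in> C" for x
      using m(2)[OF that] pos[OF that] by (simp add: pos_divide_le_eq)
    ultimately show ?thesis by blast
  qed
  then obtain \<theta> where \<theta>: "0 < \<theta>" "\<And>x. x \<in> C \<Longrightarrow> ?inc x \<le> (1 - \<theta>) * ?d x" by blast
  have "\<exists>(s', t')\<in>k. dist s s' < \<epsilon> / 4 \<and> dist t t' < \<epsilon> / 4"
    if "\<epsilon> \<le> dist s t" "(1 - \<theta>) * dist s t < incr s t G" for s t
  proof -
    have "(s, t) \<notin> C" "(s, t) \<in> D" using \<theta>(2)[of "(s, t)"] that by (auto simp: D_def)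
    then obtain x where x: "x \<in> k" "dist x (s, t) < \<epsilon> / 4" by (auto simp: C_def)
    have "dist s (fst x) < \<epsilon> / 4" "dist t (snd x) < \<epsilon> / 4"
      using x(2) dist_fst_le[of x "(s, t)"] dist_snd_le[of x "(s, t)"] by (auto simp: dist_commute)
    with x(1) show ?thesis by (auto simp: case_prod_beta)
  qed
  moreover have "\<forall>(s, t)\<in>k. s \<noteq> t \<and> incr s t G = dist s t"
    using k(1) \<epsilon> by (auto simp: \<Gamma>_def D_def)
  ultimately show ?thesis using k(2) \<theta>(1) by blast
qed

text \<open>Among \<open>n\<close> slopes, each at least \<open>- 1\<close>, the largest may exceed \<open>- 1\<close> by up to \<open>n\<close> times
  as much as their average does. Therefore the accuracy \<open>\<delta>\<close> is chosen below \<open>1 / n\<close>, where \<open>n\<close>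
  is the size of the net: an average below \<open>- 1 + \<delta>\<close> then forces all slopes to be
  negative.\<close>

lemma daugavet_steep_pair:
  fixes G :: "'a::metric_space Lip"
  assumes comp: "compact (UNIV :: 'a set)" and DP: "daugavet_property TYPE('a Lip)"
    and G: "norm G = 1" and \<epsilon>: "0 < \<epsilon>"
  shows "\<exists>s t. s \<noteq> t \<and> dist s t < \<epsilon> \<and> (1 - \<epsilon>) * dist s t < incr s t G"
proof (rule ccontr)
  assume none: "\<not> ?thesis"
  obtain k \<theta> where k: "finite k" "\<And>s t. (s, t) \<in> k \<Longrightarrow> s \<noteq> t \<and> incr s t G = dist s t"
    and \<theta>: "0 < \<theta>" and net: "\<And>s t. \<epsilon> \<le> dist s t \<Longrightarrow> (1 - \<theta>) * dist s t < incr s t G \<Longrightarrow>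
        \<exists>(s', t')\<in>k. dist s s' < \<epsilon> / 4 \<and> dist t t' < \<epsilon> / 4"
    using maximal_pairs_finite_net[OF comp G \<epsilon>] by blast
  have near: "\<exists>(s', t')\<in>k. dist s s' < \<epsilon> / 4 \<and> dist t t' < \<epsilon> / 4 \<and> \<epsilon> \<le> dist s t"
    if "s \<noteq> t" "(1 - \<delta>) * dist s t < incr s t G" "\<delta> \<le> \<epsilon>" "\<delta> \<le> \<theta>" for s t \<delta>
  proof -
    have "(1 - \<epsilon>) * dist s t \<le> (1 - \<delta>) * dist s t" "(1 - \<theta>) * dist s t \<le> (1 - \<delta>) * dist s t"
      using that by (auto intro!: mult_right_mono)
    then have "(1 - \<epsilon>) * dist s t < incr s t G" "(1 - \<theta>) * dist s t < incr s t G"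
      using that(2) by linarith+
    moreover from this(1) have "\<epsilon> \<le> dist s t" using none that(1) by force
    ultimately show ?thesis using net[of s t] by auto
  qed
  have "k \<noteq> {}"
  proof -
    define \<delta> where "\<delta> = min 1 (min \<epsilon> \<theta>)"
    have "0 < \<delta>" "\<delta> \<le> 1" "\<delta> \<le> \<epsilon>" "\<delta> \<le> \<theta>" using \<epsilon> \<theta> by (simp_all add: \<delta>_def)
    then obtain s t where "s \<noteq> t" "(1 - \<delta>) * dist s t < incr s t G"
      using steep_pair[of "1 - \<delta>" G] G by auto
    then show ?thesis using near \<open>\<delta> \<le> \<epsilon>\<close> \<open>\<delta> \<le> \<theta>\<close> by blast
  qed
  define n where "n = real (card k)"
  have n: "1 \<le> n" using k(1) \<open>k \<noteq> {}\<close> by (simp add: n_def Suc_leI card_gt_0_iff)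
  define sl where "sl x h = incr (fst x) (snd x) h / dist (fst x) (snd x)" for x and h :: "'a Lip"
  define \<phi> where "\<phi> h = (\<Sum>x\<in>k. sl x h) / n" for h
  have sl_le: "\<bar>sl x h\<bar> \<le> norm h" if "x \<in> k" for x h
    using incr_le[of "fst x" "snd x" h] k(2)[of "fst x" "snd x"] that
    by (simp add: sl_def abs_divide pos_divide_le_eq)
  have bl: "bounded_linear \<phi>"
    unfolding \<phi>_def sl_def divide_inverse
    by (intro bounded_linear_mult_const bounded_linear_sum bounded_linear_incr)
  have \<phi>G: "\<phi> G = 1"
  proof -
    have "(\<Sum>x\<in>k. sl x G) = (\<Sum>x\<in>k. 1)" using k(2) by (intro sum.cong) (auto simp: sl_def)
    then show ?thesis using n by (simp add: \<phi>_def n_def)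
  qed
  have \<phi>_le: "\<bar>\<phi> h\<bar> \<le> norm h" for h
  proof -
    have "\<bar>\<Sum>x\<in>k. sl x h\<bar> \<le> n * norm h"
      unfolding n_def using sl_le by (intro order_trans[OF sum_abs] sum_bounded_above) auto
    then show ?thesis using n by (simp add: \<phi>_def abs_divide pos_divide_le_eq mult.commute)
  qed
  define T where "T = Blinfun (\<lambda>h. \<phi> h *\<^sub>R (- G))"
  have T: "blinfun_apply T h = \<phi> h *\<^sub>R (- G)" for h
    unfolding T_def by (subst bounded_linear_Blinfun_apply)
      (rule bounded_linear_scaleR_const[OF bl] refl)+
  have "G \<noteq> 0" using G by auto
  have "range (blinfun_apply T) = span {G}"
  proof (rule set_eqI)
    fix x
    have "c *\<^sub>R G = blinfun_apply T ((- c) *\<^sub>R G)" for c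
      by (simp add: T linear_scale[OF bounded_linear.linear[OF bl]] linear_neg[OF bounded_linear.linear[OF bl]] \<phi>G)
    then show "x \<in> range (blinfun_apply T) \<longleftrightarrow> x \<in> span {G}"
      by (auto simp: span_singleton T) (metis rangeI scaleR_minus_left)
  qed
  then have "dim (range (blinfun_apply T)) = 1"
    using \<open>G \<noteq> 0\<close> by (simp add: dim_eq_card_independent)
  then have "norm (id_blinfun + T) = 1 + norm T" using DP by (simp add: daugavet_property_def)
  moreover have "1 \<le> norm T" using norm_blinfun[of T G] by (simp add: T \<phi>G G)
  ultimately have two: "2 \<le> norm (id_blinfun + T)" by simp
  define \<delta> where "\<delta> = min (min \<epsilon> \<theta>) (1 / (2 * n))"
  have \<delta>: "0 < \<delta>" "\<delta> \<le> \<epsilon>" "\<delta> \<le> \<theta>" "n * \<delta> < 1" "\<delta> \<le> 1 / 2"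
  proof -
    show "0 < \<delta>" "\<delta> \<le> \<epsilon>" "\<delta> \<le> \<theta>" using \<epsilon> \<theta> n by (simp_all add: \<delta>_def)
    have "\<delta> \<le> 1 / (2 * n)" by (simp add: \<delta>_def)
    moreover have "1 / (2 * n) \<le> 1 / 2" using n by (simp add: field_simps)
    ultimately show "\<delta> \<le> 1 / 2" by linarith
    have "n * \<delta> \<le> n * (1 / (2 * n))" using n by (intro mult_left_mono) (auto simp: \<delta>_def)
    also have "\<dots> < 1" using n by simp
    finally show "n * \<delta> < 1" .
  qed
  obtain y0 where y0: "norm y0 = 1" "2 - \<delta> < norm (blinfun_apply (id_blinfun + T) y0)"
    using blinfun_nearly_attained[of "2 - \<delta>" "id_blinfun + T"] two \<delta> by auto
  \<comment> \<open>The norm of \<open>y + T y\<close> is even in \<open>y\<close>, so the sign of \<open>\<phi> y\<close> is free.\<close>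
  define y where "y = (if \<phi> y0 \<le> 0 then y0 else - y0)"
  have y: "norm y = 1" "\<phi> y \<le> 0" "2 - \<delta> < norm (y - \<phi> y *\<^sub>R G)"
  proof -
    show "norm y = 1" "\<phi> y \<le> 0"
      using y0 by (auto simp: y_def linear_neg[OF bounded_linear.linear[OF bl]])
    have "norm (y - \<phi> y *\<^sub>R G) = norm (y0 - \<phi> y0 *\<^sub>R G)"
      by (simp add: y_def linear_neg[OF bounded_linear.linear[OF bl]] norm_minus_commute)
    then show "2 - \<delta> < norm (y - \<phi> y *\<^sub>R G)" using y0(2) by (simp add: blinfun.add_left T)
  qed
  have \<phi>y: "- 1 \<le> \<phi> y" "\<phi> y < - 1 + \<delta>"
  proof -
    show "- 1 \<le> \<phi> y" using \<phi>_le[of y] y by simp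
    have "norm (y - \<phi> y *\<^sub>R G) \<le> norm y + norm (\<phi> y *\<^sub>R G)" by (rule norm_triangle_ineq4)
    then show "\<phi> y < - 1 + \<delta>" using y G by simp
  qed
  obtain s t where st: "s \<noteq> t" "(2 - \<delta>) * dist s t < incr s t (y - \<phi> y *\<^sub>R G)"
    using steep_pair[of "2 - \<delta>" "y - \<phi> y *\<^sub>R G"] y \<delta> by auto
  then have sum_gt: "(2 - \<delta>) * dist s t < incr s t y + (- \<phi> y) * incr s t G"
    by (simp add: incr_linear_simps)
  have "(- \<phi> y) * incr s t G \<le> (- \<phi> y) * dist s t"
    using y(2) incr_le[of s t G] G by (intro mult_left_mono) auto
  also have "\<dots> \<le> 1 * dist s t" using \<phi>y by (intro mult_right_mono) auto
  finally have "(- \<phi> y) * incr s t G \<le> dist s t" by simp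
  then have y_steep: "(1 - \<delta>) * dist s t < incr s t y" using sum_gt by (simp add: algebra_simps)
  have G_pos: "(1 - \<delta>) * dist s t < (- \<phi> y) * incr s t G"
    using sum_gt incr_le[of s t y] y(1) by (simp add: algebra_simps)
  have "0 \<le> (1 - \<delta>) * dist s t" using \<delta> by simp
  then have "0 < (- \<phi> y) * incr s t G" using G_pos by linarith
  then have "0 < incr s t G" using y(2) by (auto simp: zero_less_mult_iff mult_less_0_iff)
  then have "(- \<phi> y) * incr s t G \<le> 1 * incr s t G"
    using \<phi>y by (intro mult_right_mono) auto
  then have "(1 - \<delta>) * dist s t < incr s t G" using G_pos by simp
  then obtain s' t' where st': "(s', t') \<in> k" "dist s s' < \<epsilon> / 4" "dist t t' < \<epsilon> / 4" "\<epsilon> \<le> dist s t"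
    using near[OF st(1) _ \<delta>(2,3)] by blast
  \<comment> \<open>Moving from \<open>(s, t)\<close> to the nearby pair of the net costs less than \<open>\<epsilon> / 2\<close>, and hence less than the
    increment of \<open>y\<close> on \<open>(s, t)\<close>.\<close>
  have "incr s t y \<le> dist s s' + incr s' t' y + dist t t'"
    using incr_trans[of s s' y t'] incr_trans[of s t' y t] incr_le[of s s' y] incr_le[of t' t y] y(1)
    by (simp add: dist_commute)
  moreover have "(1 / 2) * \<epsilon> \<le> (1 - \<delta>) * dist s t" using st' \<delta> \<epsilon> by (intro mult_mono) auto
  ultimately have "0 < incr s' t' y" using y_steep st' by linarith
  then have pos: "0 < sl (s', t') y" using k(2)[OF st'(1)] by (simp add: sl_def)
  have "- (n - 1) = (\<Sum>x\<in>k - {(s', t')}. - 1)" using k(1) st'(1) n by (simp add: n_def of_nat_diff)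
  also have "\<dots> \<le> (\<Sum>x\<in>k - {(s', t')}. sl x y)"
  proof (rule sum_mono)
    show "- 1 \<le> sl x y" if "x \<in> k - {(s', t')}" for x using sl_le[of x y] that y(1) by auto
  qed
  also have "\<dots> = n * \<phi> y - sl (s', t') y"
    using k(1) st'(1) n by (simp add: \<phi>_def sum.remove[of k "(s', t')"])
  finally have "1 - n < n * \<phi> y" using pos by simp
  also have "\<dots> \<le> n * (- 1 + \<delta>)" using \<phi>y n by (intro mult_left_mono) auto
  finally show False using \<delta>(4) by (simp add: algebra_simps)
qed

text \<open>It remains to rescale to norm \<open>1\<close>. For \<open>F = 0\<close> any pair at distance less than \<open>\<epsilon>\<close> will
  do, and one is found as a steep pair of another function, here the distance from \<open>a\<close>.\<close>

lemma daugavet_imp_local: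
  assumes comp: "compact (UNIV :: 'a::metric_space set)" and DP: "daugavet_property TYPE('a Lip)"
    and "a \<noteq> (b :: 'a)"
  shows "local_metric_space TYPE('a)"
  unfolding local_metric_space_def
proof (intro allI impI)
  fix \<epsilon> :: real and f :: "'a \<Rightarrow> real"
  assume \<epsilon>: "0 < \<epsilon>" and f: "is_lipschitz f"
  define F where "F = abs_Lip f"
  have "\<exists>s t. s \<noteq> t \<and> dist s t < \<epsilon> \<and> (norm F - \<epsilon>) * dist s t < incr s t F"
  proof (cases "F = 0")
    case True
    have d: "is_lipschitz (dist a)" by (rule is_lipschitzI[of _ 1]) metric
    define D where "D = abs_Lip (dist a)"
    have "incr a b D \<noteq> 0" using \<open>a \<noteq> b\<close> by (simp add: D_def incr_abs_Lip[OF d])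
    then have "D \<noteq> 0" using incr_le[of a b D] by auto
    then have "norm (D /\<^sub>R norm D) = 1" by simp
    then obtain s t :: 'a where "s \<noteq> t" "dist s t < \<epsilon>"
      using daugavet_steep_pair[OF comp DP _ \<epsilon>] by blast
    moreover have "incr s t F = 0" using True incr_le[of s t F] by simp
    moreover have "0 < \<epsilon> * dist s t" using \<open>s \<noteq> t\<close> \<epsilon> by simp
    ultimately show ?thesis using True by (intro exI[of _ s] exI[of _ t]) simp
  next
    case False
    define \<eta> where "\<eta> = min \<epsilon> (\<epsilon> / norm F)"
    have "0 < \<eta>" using False \<epsilon> by (simp add: \<eta>_def)
    then obtain s t where st: "s \<noteq> t" "dist s t < \<eta>" "(1 - \<eta>) * dist s t < incr s t (F /\<^sub>R norm F)"
      using daugavet_steep_pair[OF comp DP, of "F /\<^sub>R norm F" \<eta>] False by auto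
    have "norm F * \<eta> \<le> norm F * (\<epsilon> / norm F)" by (intro mult_left_mono) (auto simp: \<eta>_def)
    then have "norm F * \<eta> \<le> \<epsilon>" using False by simp
    then have "(norm F - \<epsilon>) * dist s t \<le> (norm F - norm F * \<eta>) * dist s t"
      by (intro mult_right_mono) auto
    also have "\<dots> = norm F * ((1 - \<eta>) * dist s t)" by (simp add: algebra_simps)
    also have "\<dots> < norm F * incr s t (F /\<^sub>R norm F)" using st(3) False by simp
    also have "\<dots> = incr s t F" using False by (simp add: incr_linear_simps)
    finally show ?thesis using st by (auto simp: \<eta>_def)
  qed
  then obtain s t where "s \<noteq> t" "dist s t < \<epsilon>" "(norm F - \<epsilon>) * dist s t < incr s t F"
    by blast
  then show "\<exists>\<tau>\<^sub>1 \<tau>\<^sub>2. \<tau>\<^sub>1 \<noteq> \<tau>\<^sub>2 \<and> dist \<tau>\<^sub>1 \<tau>\<^sub>2 < \<epsilon> \<and>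
        (f \<tau>\<^sub>2 - f \<tau>\<^sub>1) / dist \<tau>\<^sub>1 \<tau>\<^sub>2 > lip_seminorm f - \<epsilon>"
    by (intro exI[of _ s] exI[of _ t])
      (simp add: F_def incr_abs_Lip[OF f] norm_abs_Lip[OF f] pos_less_divide_eq)
qed

theorem theorem3p3:
  assumes "compact (UNIV :: 'a::metric_space set)"
    and "\<nexists>x :: 'a. UNIV = {x}"
  shows "daugavet_property TYPE('a Lip) \<longleftrightarrow> local_metric_space TYPE('a)"
proof
  obtain a b :: 'a where "a \<noteq> b" using assms(2) by blast
  then show "local_metric_space TYPE('a)" if "daugavet_property TYPE('a Lip)"
    using daugavet_imp_local[OF assms(1) that] by blast
  show "daugavet_property TYPE('a Lip)" if "local_metric_space TYPE('a)"
    by (rule midpoints_imp_daugavet[OF compact_local_midpoint[OF assms(1) that]])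
qed

end
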